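(* Let $G$ be a threshold graph with $n$ vertices and edge set $E$. For any integer $k$ with $1\le k\le n$, $$\sum_{i=n+1-k}^{n}\lambda_i(Q(G))\le |E|+\binom{k+1}{2},$$ where $\lambda_1(Q(G))\le\dots\le\lambda_n(Q(G))$ are the eigenvalues of the signless Laplacian $Q(G)$.
   Context: The signless Laplacian of a finite simple graph $G$ is $Q(G)=D+A$, where $A$ is the adjacency matrix and $D$ the diagonal matrix of vertex degrees. A threshold graph is a graph obtained from a single vertex by iteratively adding, at each step, either an isolated vertex or a dominating vertex (adjacent to all previously added vertices). *)

theory Defs
  imports "Jordan_Normal_Form.Char_Poly"
begin

definition simple_graph :: "'a set \<Rightarrow> 'a set set \<Rightarrow> bool" where
  "simple_graph V E \<longleftrightarrow> finite V \<and> (\<forall>e\<in>E. e \<subseteq> V \<and> card e = 2)"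

inductive threshold_graph :: "'a set \<Rightarrow> 'a set set \<Rightarrow> bool" where
  single: "threshold_graph {v} {}"
| isolated: "threshold_graph V E \<Longrightarrow> v \<notin> V \<Longrightarrow> threshold_graph (insert v V) E"
| dominating: "threshold_graph V E \<Longrightarrow> v \<notin> V \<Longrightarrow>
    threshold_graph (insert v V) (E \<union> {{u, v} | u. u \<in> V})"

lemma threshold_graph_simple_graph: "threshold_graph V E \<Longrightarrow> simple_graph V E"
  by (induction rule: threshold_graph.induct) (auto simp: simple_graph_def card_2_iff)

definition vertex_degree :: "'a set set \<Rightarrow> 'a \<Rightarrow> nat" where
  "vertex_degree E v = card {e \<in> E. v \<in> e}"

text \<open>Matrices are indexed by \<open>{0..<n}\<close>, so the vertices have to be enumerated:
  below, \<open>vs\<close> is a list containing each vertex exactly once.\<close>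

definition adjacency_matrix :: "'a list \<Rightarrow> 'a set set \<Rightarrow> real mat" where
  "adjacency_matrix vs E = mat (length vs) (length vs)
     (\<lambda>(i, j). if {vs ! i, vs ! j} \<in> E then 1 else 0)"

definition degree_matrix :: "'a list \<Rightarrow> 'a set set \<Rightarrow> real mat" where
  "degree_matrix vs E = mat (length vs) (length vs)
     (\<lambda>(i, j). if i = j then real (vertex_degree E (vs ! i)) else 0)"

definition signless_laplacian :: "'a list \<Rightarrow> 'a set set \<Rightarrow> real mat" where
  "signless_laplacian vs E = degree_matrix vs E + adjacency_matrix vs E"

text \<open>\<open>asc_eigenvalue A i\<close> is the \<open>i\<close>-th smallest eigenvalue (\<open>i\<close> counted from 1),
  with algebraic multiplicity. Only real roots of the characteristic polynomial are listed;
  for symmetric \<open>A\<close> these are all of them (lemma \<open>length_asc_eigenvalues\<close>).\<close>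

definition asc_eigenvalues :: "real mat \<Rightarrow> real list" where
  "asc_eigenvalues A = sorted_list_of_multiset (proots (char_poly A))"

definition asc_eigenvalue :: "real mat \<Rightarrow> nat \<Rightarrow> real" where
  "asc_eigenvalue A i = asc_eigenvalues A ! (i - 1)"

lemma signless_laplacian_carrier [simp]:
  "signless_laplacian vs E \<in> carrier_mat (length vs) (length vs)"
  by (simp add: signless_laplacian_def degree_matrix_def adjacency_matrix_def)

lemma transpose_signless_laplacian: "(signless_laplacian vs E)\<^sup>T = signless_laplacian vs E"
  by (rule eq_matI)
    (auto simp: signless_laplacian_def degree_matrix_def adjacency_matrix_def insert_commute)

lemma symmetric_complex_root_real:
  fixes A :: "real mat"
  assumes A: "A \<in> carrier_mat n n" and sym: "A\<^sup>T = A"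
    and root: "poly (char_poly (map_mat complex_of_real A)) z = 0"
  shows "z \<in> \<real>"
proof -
  let ?B = "map_mat complex_of_real A"
  have B: "?B \<in> carrier_mat n n" using A by simp
  from root have "eigenvalue ?B z" by (simp add: eigenvalue_root_char_poly[OF B])
  then obtain v where v: "v \<in> carrier_vec n" "v \<noteq> 0\<^sub>v n" and ev: "?B *\<^sub>v v = z \<cdot>\<^sub>v v"
    using B by (auto simp: eigenvalue_def eigenvector_def)
  have cB: "conjugate (?B *\<^sub>v v) = ?B *\<^sub>v conjugate v"
    using A v by (intro eq_vecI)
      (auto simp: scalar_prod_def sum_conjugate conjugate_dist_mul)
  have tB: "?B\<^sup>T = ?B" using sym by (metis map_mat_transpose)
  have "z * (v \<bullet> conjugate v) = (?B *\<^sub>v v) \<bullet> conjugate v"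
    using v by (simp add: ev)
  also have "\<dots> = v \<bullet> (?B *\<^sub>v conjugate v)"
    using transpose_vec_mult_scalar[OF B, of "conjugate v" v] v tB B
    by (metis carrier_vec_conjugate comm_scalar_prod mult_mat_vec_carrier)
  also have "\<dots> = v \<bullet> conjugate (z \<cdot>\<^sub>v v)" using cB ev by simp
  also have "\<dots> = cnj z * (v \<bullet> conjugate v)"
    using v by (simp add: conjugate_smult_vec)
  finally have "z = cnj z" using v by simp
  then show ?thesis by (metis Reals_cnj_iff)
qed

lemma proots_prod_list_linear: "proots (\<Prod>a\<leftarrow>xs. [:- a, 1:]) = mset (xs :: real list)"
proof (induction xs)
  case (Cons x xs)
  have "(\<Prod>a\<leftarrow>xs. [:- a, 1:]) \<noteq> 0" by (auto simp: prod_list_zero_iff)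
  with Cons show ?case by (simp add: proots_mult del: mult_pCons_left)
qed simp

lemma length_asc_eigenvalues:
  assumes A: "A \<in> carrier_mat n n" and sym: "A\<^sup>T = A"
  shows "length (asc_eigenvalues A) = n"
proof -
  interpret P: map_poly_inj_comm_ring_hom complex_of_real ..
  let ?p = "char_poly A" and ?q = "char_poly (map_mat complex_of_real A)"
  have q: "?q = map_poly complex_of_real ?p" by (rule of_real_hom.char_poly_hom[OF A])
  have B: "map_mat complex_of_real A \<in> carrier_mat n n" using A by simp
  obtain M where cp: "?q = (\<Prod>a\<leftarrow>M. [:- a, 1:])" and len: "length M = n"
    using char_poly_factorized[OF B] by blast
  have "set M \<subseteq> \<real>"
  proof
    fix z assume "z \<in> set M"
    then have "poly ?q z = 0" by (force simp: cp poly_prod_list prod_list_zero_iff)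
    then show "z \<in> \<real>" by (rule symmetric_complex_root_real[OF A sym])
  qed
  then have M: "M = map complex_of_real (map Re M)"
    by (auto simp: map_idI subset_iff of_real_Re)
  have "map_poly complex_of_real ?p = map_poly complex_of_real (\<Prod>a\<leftarrow>map Re M. [:- a, 1:])"
    unfolding q[symmetric] cp by (subst M) (simp add: P.hom_prod_list o_def)
  then have "?p = (\<Prod>a\<leftarrow>map Re M. [:- a, 1:])" by simp
  then have "proots ?p = mset (map Re M)"
    by (simp only: proots_prod_list_linear)
  then show ?thesis using len by (simp add: asc_eigenvalues_def flip: size_mset)
qed

end

theory Submission
  imports Defs "Jordan_Normal_Form.Schur_Decomposition"
begin

text \<open>Let \<open>h\<close> be the number of dominating vertices added while building the graph, \<open>n\<close> the number of
vertices and \<open>Q\<close> the signless Laplacian. The theorem follows from one inequality about the part of the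
spectrum below the level \<open>h\<close>: there are vectors \<open>z\<close> with
\<open>Q - h I + (\<Sum>z. z z\<^sup>T) \<ge> 0\<close> (in the positive semidefinite order) and
\<open>(\<Sum>z. |z|\<^sup>2) \<le> n h - |E| - (h choose 2)\<close>. Evaluating the first inequality on orthonormal eigenvectors
for the \<open>n - k\<close> smallest eigenvalues shows that these add up to at least
\<open>(n - k) h - (n h - |E| - (h choose 2))\<close>. Since all eigenvalues together add up to \<open>2 |E|\<close>, the \<open>k\<close> largest add
up to at most \<open>|E| + k h - (h choose 2)\<close>, and \<open>(k + 1 choose 2) + (h choose 2) - k h\<close> equals
\<open>(k - h) (k - h + 1) / 2\<close>, which is never negative for integers. So a single \<open>h\<close> serves all \<open>k\<close>
(\<open>certificate_eigenvalue_sum\<close>, \<open>mult_le_choose_two_add\<close>).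

The vectors \<open>z\<close> are found by induction along the construction of the graph. Write \<open>A = Q - h I\<close>. An isolated
vertex puts a new diagonal entry \<open>- h\<close> into \<open>A\<close>, which one vector of squared length \<open>h\<close> compensates; this is
exactly the growth of the bound. A dominating vertex borders \<open>A\<close> by a row and column of ones, with the corner
entry \<open>n - h - 1\<close>, while the bound grows only by \<open>1\<close>; so a single new unit vector has to suffice. It does only
if \<open>A + (\<Sum>z. z z\<^sup>T)\<close> is already large in the direction of the all-ones vector. The induction therefore carries
the stronger claim \<open>A + (\<Sum>z. z z\<^sup>T) \<ge> h / (h + 1) c c\<^sup>T\<close> for a vector \<open>c\<close> whose entries add up to \<open>h + 1\<close> and
whose squared length is at most \<open>h + 1\<close>. The model case is the complete graph on \<open>h + 1\<close> vertices together with
isolated vertices, \<open>c\<close> being the indicator of the clique. With this rank-one bound the step for a dominating vertex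
(\<open>certificate_dominating\<close>) involves the argument vector only through three numbers (its value at the new vertex, its
inner product with \<open>c\<close>, and its sum), and becomes the inequality \<open>dominating_step_form\<close> between quadratic forms
in three variables.\<close>

section \<open>Orthogonal diagonalization of real symmetric matrices\<close>

text \<open>Completing an eigenvector to a basis and applying Gram-Schmidt gives pairwise orthogonal columns, the first of which
is still the eigenvector; rescaling them to unit length makes the matrix orthogonal.\<close>
lemma orthogonal_mat_with_eigenvector:
  fixes A :: "real mat"
  assumes A: "A \<in> carrier_mat n n" and ev: "eigenvalue A e"
  obtains W where "W \<in> carrier_mat n n" "W\<^sup>T * W = 1\<^sub>m n"
    "A *\<^sub>v col W 0 = e \<cdot>\<^sub>v col W 0"
proof -
  obtain v where v: "v \<in> carrier_vec n" "v \<noteq> 0\<^sub>v n" and Av: "A *\<^sub>v v = e \<cdot>\<^sub>v v"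
    using ev A unfolding eigenvalue_def eigenvector_def by auto
  have n: "n \<noteq> 0"
  proof
    assume "n = 0"
    then have "v = 0\<^sub>v n" using v by (intro eq_vecI) auto
    with v show False by simp
  qed
  interpret cof_vec_space n "TYPE(real)" .
  define b where "b = basis_completion v"
  define ws where "ws = gram_schmidt n b"
  from basis_completion[OF v, folded b_def]
  have dist_b: "distinct b" and indep: "\<not> lin_dep (set b)" and b: "set b \<subseteq> carrier_vec n"
    and hdb: "hd b = v" and len_b: "length b = n" by auto
  from hdb len_b n obtain vs where bv: "b = v # vs" by (cases b) auto
  from gram_schmidt_result[OF b dist_b indep refl, folded ws_def]
  have ws: "set ws \<subseteq> carrier_vec n" "corthogonal ws" "length ws = n"
    by (auto simp: len_b)
  have hdws: "hd ws = v" using gram_schmidt_hd[OF v(1), of vs, folded bv] by (simp add: ws_def)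
  define us where "us = map (\<lambda>w. (1 / sqrt (w \<bullet> w)) \<cdot>\<^sub>v w) ws"
  define W where "W = mat_of_cols n us"
  have wsi: "ws ! i \<in> carrier_vec n" if "i < n" for i using ws that by auto
  have W: "W \<in> carrier_mat n n" by (simp add: W_def us_def ws(3) mat_of_cols_def)
  have col: "col W i = (1 / sqrt (ws ! i \<bullet> ws ! i)) \<cdot>\<^sub>v ws ! i" if "i < n" for i
    unfolding W_def using that wsi[OF that] ws(3) by (subst col_mat_of_cols) (auto simp: us_def)
  have orth: "(ws ! i \<bullet> ws ! j = 0) = (i \<noteq> j)" if "i < n" "j < n" for i j
    using corthogonalD[OF ws(2), of i j] that ws(3) by (simp add: conjugate_vec_def)
  have "W\<^sup>T * W = 1\<^sub>m n"
  proof (rule eq_matI)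
    fix i j assume "i < dim_row (1\<^sub>m n)" "j < dim_col (1\<^sub>m n)"
    then have ij: "i < n" "j < n" by auto
    have "(W\<^sup>T * W) $$ (i, j) = col W i \<bullet> col W j" using W ij by simp
    also have "\<dots> = (ws ! i \<bullet> ws ! j) / (sqrt (ws ! i \<bullet> ws ! i) * sqrt (ws ! j \<bullet> ws ! j))"
      using wsi[OF ij(1)] wsi[OF ij(2)] by (simp add: col ij)
    also have "\<dots> = 1\<^sub>m n $$ (i, j)"
    proof (cases "i = j")
      case True
      have "ws ! i \<bullet> ws ! i \<ge> 0" by (simp add: scalar_prod_def sum_nonneg)
      with True orth[OF ij] ij show ?thesis by simp
    qed (use orth[OF ij] ij in simp)
    finally show "(W\<^sup>T * W) $$ (i, j) = 1\<^sub>m n $$ (i, j)" .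
  qed (use W in auto)
  moreover have "A *\<^sub>v col W 0 = e \<cdot>\<^sub>v col W 0"
  proof -
    have "ws ! 0 = v" using hdws ws(3) n by (cases ws) auto
    then show ?thesis using col[of 0] n A v Av
      by (simp add: mult_mat_vec smult_smult_assoc mult.commute)
  qed
  ultimately show ?thesis using that W by blast
qed

text \<open>The deflation argument of the Schur decomposition, carried out with orthogonal matrices. The eigenvalues appear on the
diagonal in the prescribed order \<open>es\<close>, which later makes it possible to speak of the eigenvectors of the smallest
eigenvalues.\<close>
lemma symmetric_orthogonal_diagonalization:
  fixes A :: "real mat"
  assumes "A \<in> carrier_mat n n" and "A\<^sup>T = A" and "char_poly A = (\<Prod>e\<leftarrow>es. [:- e, 1:])"
  obtains U where "U \<in> carrier_mat n n" "U\<^sup>T * U = 1\<^sub>m n"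
    "diagonal_mat (U\<^sup>T * A * U)" "diag_mat (U\<^sup>T * A * U) = es"
proof -
  have "\<exists>U\<in>carrier_mat n n. U\<^sup>T * U = 1\<^sub>m n \<and>
    diagonal_mat (U\<^sup>T * A * U) \<and> diag_mat (U\<^sup>T * A * U) = es"
    using assms
  proof (induction es arbitrary: n A)
    case Nil
    with degree_monic_char_poly[of A n] have "n = 0" by simp
    with Nil show ?case
      by (intro bexI[of _ "1\<^sub>m 0"]) (auto simp: diagonal_mat_def diag_mat_def)
  next
    case (Cons e es n A)
    note A = Cons.prems(1)
    let ?m = "n - 1"
    have cp: "char_poly A = [:- e, 1:] * (\<Prod>e\<leftarrow>es. [:- e, 1:])" using Cons.prems(3) by simp
    then have ev: "eigenvalue A e" by (simp add: eigenvalue_root_char_poly[OF A])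
    have n: "n \<noteq> 0"
    proof
      assume "n = 0"
      then show False using degree_monic_char_poly[OF A] Cons.prems(3)
        by (metis degree_linear_factors length_Cons nat.distinct(1))
    qed
    obtain W where W: "W \<in> carrier_mat n n" and WW: "W\<^sup>T * W = 1\<^sub>m n"
      and We: "A *\<^sub>v col W 0 = e \<cdot>\<^sub>v col W 0"
      using orthogonal_mat_with_eigenvector[OF A ev] .
    define B where "B = W\<^sup>T * A * W"
    have B: "B \<in> carrier_mat n n" using A W by (simp add: B_def)
    have symB: "B\<^sup>T = B"
      using A W Cons.prems(2) by (simp add: B_def transpose_mult[of _ n n _ n] assoc_mult_mat[of _ n n _ n _ n])
    \<comment> \<open>The first column of \<open>B\<close> is an eigenvector equation; by symmetry the first row vanishes too, so the
      problem splits off a \<open>1 \<times> 1\<close> block.\<close>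
    have B0: "B $$ (i, 0) = (if i = 0 then e else 0)" if i: "i < n" for i
    proof -
      have "B $$ (i, 0) = (W\<^sup>T * (A * W)) $$ (i, 0)"
        using A W by (simp add: B_def assoc_mult_mat[of _ n n _ n _ n])
      also have "\<dots> = row W\<^sup>T i \<bullet> col (A * W) 0"
        by (rule index_mult_mat) (use A W i n in auto)
      also have "\<dots> = col W i \<bullet> (A *\<^sub>v col W 0)"
        unfolding col_mult2[OF A W n[unfolded neq0_conv]] using W i by simp
      also have "\<dots> = e * (col W i \<bullet> col W 0)" using W i n unfolding We by simp
      also have "col W i \<bullet> col W 0 = (W\<^sup>T * W) $$ (i, 0)" using W i n by simp
      finally show ?thesis using i n unfolding WW by simp
    qed
    have B0': "B $$ (0, i) = (if i = 0 then e else 0)" if i: "i < n" for i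
      using B0[OF i] symB B i n by (metis carrier_matD gr0I index_transpose_mat(1))
    define B3 where "B3 = mat ?m ?m (\<lambda>(i, j). B $$ (Suc i, Suc j))"
    have B3: "B3 \<in> carrier_mat ?m ?m" by (simp add: B3_def)
    let ?e = "mat 1 1 (\<lambda>_. e)"
    have Bb: "B = four_block_mat ?e (0\<^sub>m 1 ?m) (0\<^sub>m ?m 1) B3"
      by (rule eq_matI) (use B B0 B0' n in \<open>auto simp: B3_def\<close>)
    have symB3: "B3\<^sup>T = B3"
    proof (rule eq_matI)
      fix i j assume "i < dim_row B3" "j < dim_col B3"
      then have ij: "i < ?m" "j < ?m" using B3 by auto
      then have "B\<^sup>T $$ (Suc i, Suc j) = B $$ (Suc j, Suc i)" using B by simp
      with ij symB show "B3\<^sup>T $$ (i, j) = B3 $$ (i, j)" by (simp add: B3_def)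
    qed (use B3 in auto)
    have "W * W\<^sup>T = 1\<^sub>m n" using mat_mult_left_right_inverse[OF _ W WW] W by simp
    then have "similar_mat_wit B A (W\<^sup>T) W"
      using W A B WW by (intro similar_mat_witI[of _ _ n]) (auto simp: B_def)
    then have "char_poly B = char_poly A"
      by (intro char_poly_similar) (auto simp: similar_mat_def)
    moreover have "char_poly B = char_poly ?e * char_poly B3"
      unfolding Bb by (rule char_poly_four_block_zeros_col[of _ _ ?m]) (use B3 in auto)
    moreover have "char_poly ?e = [:- e, 1:]" by (simp add: char_poly_defs det_def sign_def)
    ultimately have "char_poly B3 = (\<Prod>e\<leftarrow>es. [:- e, 1:])"
      using cp by (metis mult_cancel_left pCons_eq_0_iff zero_neq_one)
    from Cons.IH[OF B3 symB3 this] obtain U where U: "U \<in> carrier_mat ?m ?m"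
      and UU: "U\<^sup>T * U = 1\<^sub>m ?m" and dU: "diagonal_mat (U\<^sup>T * B3 * U)"
      and eU: "diag_mat (U\<^sup>T * B3 * U) = es" by blast
    define P where "P = four_block_mat (1\<^sub>m 1) (0\<^sub>m 1 ?m) (0\<^sub>m ?m 1) U"
    have P: "P \<in> carrier_mat n n" using U n unfolding P_def carrier_mat_def by simp
    have PT: "P\<^sup>T = four_block_mat (1\<^sub>m 1) (0\<^sub>m 1 ?m) (0\<^sub>m ?m 1) U\<^sup>T"
      using U unfolding P_def by (subst transpose_four_block_mat[of _ 1 1 _ ?m _ ?m]) auto
    have PP: "P\<^sup>T * P = 1\<^sub>m n"
    proof -
      have "P\<^sup>T * P = four_block_mat (1\<^sub>m 1) (0\<^sub>m 1 ?m) (0\<^sub>m ?m 1) (1\<^sub>m ?m)"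
        using U UU unfolding PT unfolding P_def
        by (subst mult_four_block_mat[of _ 1 1 _ ?m _ ?m _ _ 1 _ ?m]) auto
      also have "\<dots> = 1\<^sub>m n" by (rule eq_matI) (use n in auto)
      finally show ?thesis .
    qed
    have PBP: "P\<^sup>T * B * P = four_block_mat ?e (0\<^sub>m 1 ?m) (0\<^sub>m ?m 1) (U\<^sup>T * B3 * U)"
    proof -
      have "P\<^sup>T * B = four_block_mat ?e (0\<^sub>m 1 ?m) (0\<^sub>m ?m 1) (U\<^sup>T * B3)"
        using U B3 unfolding PT unfolding Bb
        by (subst mult_four_block_mat[of _ 1 1 _ ?m _ ?m _ _ 1 _ ?m]) auto
      then show ?thesis
        using U B3 unfolding P_def
        by (simp, subst mult_four_block_mat[of _ 1 1 _ ?m _ ?m _ _ 1 _ ?m]) auto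
    qed
    have "(W * P)\<^sup>T * (W * P) = P\<^sup>T * (W\<^sup>T * W) * P"
      using W P by (simp add: transpose_mult[of _ n n _ n] assoc_mult_mat[of _ n n _ n _ n])
    then have orth: "(W * P)\<^sup>T * (W * P) = 1\<^sub>m n"
      using P by (simp add: WW PP)
    have "(W * P)\<^sup>T * A * (W * P) = P\<^sup>T * B * P"
      using W P A by (simp add: B_def transpose_mult[of _ n n _ n] assoc_mult_mat[of _ n n _ n _ n])
    then have D: "(W * P)\<^sup>T * A * (W * P) =
        four_block_mat ?e (0\<^sub>m 1 ?m) (0\<^sub>m ?m 1) (U\<^sup>T * B3 * U)" using PBP by simp
    have "diag_mat ((W * P)\<^sup>T * A * (W * P)) = diag_mat ?e @ diag_mat (U\<^sup>T * B3 * U)"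
      unfolding D by (rule diag_four_block_mat) (use U B3 in auto)
    then have "diag_mat ((W * P)\<^sup>T * A * (W * P)) = e # es" unfolding eU by (simp add: diag_mat_def)
    moreover have "diagonal_mat ((W * P)\<^sup>T * A * (W * P))"
    proof -
      define M where "M = U\<^sup>T * B3 * U"
      have "M \<in> carrier_mat ?m ?m" using U B3 by (simp add: M_def)
      then show ?thesis
        unfolding D using dU unfolding M_def[symmetric] by (auto simp: diagonal_mat_def)
    qed
    ultimately show ?case using orth W P by (intro bexI[of _ "W * P"]) auto
  qed
  then show ?thesis using that by blast
qed

lemma monic_eq_prod_proots:
  fixes p :: "real poly"
  assumes "monic p" and "size (proots p) = degree p"
  shows "p = (\<Prod>x\<in>#proots p. [:- x, 1:])"
  using assms
proof (induction "degree p" arbitrary: p)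
  case 0
  then have "p = 1" by (simp add: monic_degree_0)
  then show ?case by simp
next
  case (Suc d)
  then have "proots p \<noteq> {#}" by auto
  then obtain x where "x \<in># proots p" by blast
  then have "poly p x = 0" using Suc.prems(1) by (cases "p = 0") auto
  then obtain q where p: "p = [:- x, 1:] * q" by (auto simp: poly_eq_0_iff_dvd)
  have q: "monic q" using Suc.prems(1) unfolding p by (simp add: lead_coeff_mult del: mult_pCons_left)
  then have q0: "q \<noteq> 0" by auto
  then have deg: "degree p = Suc (degree q)" unfolding p by (subst degree_mult_eq) auto
  have roots: "proots p = add_mset x (proots q)" unfolding p using q0 by (subst proots_mult) auto
  have "q = (\<Prod>x\<in>#proots q. [:- x, 1:])"
    using Suc.hyps(2) Suc.prems(2) deg roots q by (intro Suc.hyps(1)) auto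
  then show ?case unfolding roots by (simp add: p del: mult_pCons_left)
qed

lemma char_poly_eq_prod_asc_eigenvalues:
  assumes A: "A \<in> carrier_mat n n" and sym: "A\<^sup>T = A"
  shows "char_poly A = (\<Prod>e\<leftarrow>asc_eigenvalues A. [:- e, 1:])"
proof -
  have mset: "mset (asc_eigenvalues A) = proots (char_poly A)"
    by (simp add: asc_eigenvalues_def)
  have "size (proots (char_poly A)) = n"
    using length_asc_eigenvalues[OF A sym] by (simp flip: mset)
  then have "char_poly A = (\<Prod>x\<in>#proots (char_poly A). [:- x, 1:])"
    using degree_monic_char_poly[OF A] by (intro monic_eq_prod_proots) auto
  then show ?thesis by (simp flip: mset prod_mset_prod_list)
qed

section \<open>The quadratic form of the signless Laplacian\<close>

text \<open>Functions on the vertex set take the place of vectors, so that adding a vertex to the graph needs no reindexing.\<close>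
definition inner_on :: "'a set \<Rightarrow> ('a \<Rightarrow> real) \<Rightarrow> ('a \<Rightarrow> real) \<Rightarrow> real" where
  "inner_on V x y = (\<Sum>v\<in>V. x v * y v)"

text \<open>The quadratic form of the signless Laplacian as a sum of squares over the edges, independent of any enumeration of
the vertices.\<close>
definition edge_form :: "'a set set \<Rightarrow> ('a \<Rightarrow> real) \<Rightarrow> real" where
  "edge_form E x = (\<Sum>e\<in>E. (\<Sum>u\<in>e. x u)\<^sup>2)"

lemma inner_on_insert:
  assumes "finite V" "v \<notin> V"
  shows "inner_on (insert v V) x y = x v * y v + inner_on V x y"
  using assms by (simp add: inner_on_def)

lemma inner_on_cong:
  assumes "\<And>u. u \<in> V \<Longrightarrow> x u = x' u" "\<And>u. u \<in> V \<Longrightarrow> y u = y' u"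
  shows "inner_on V x y = inner_on V x' y'"
  unfolding inner_on_def using assms by (auto intro!: sum.cong)

lemma inner_on_fun_upd [simp]:
  assumes "v \<notin> V"
  shows "inner_on V (x(v := a)) y = inner_on V x y" "inner_on V x (y(v := a)) = inner_on V x y"
  using assms by (auto intro!: inner_on_cong)

lemma inner_on_extend_by_zero:
  assumes "finite V" "v \<notin> V"
  shows "inner_on (insert v V) (z(v := 0)) (z(v := 0)) = inner_on V z z"
    "inner_on (insert v V) (z(v := 0)) x = inner_on V z x"
  using assms by (simp_all add: inner_on_insert)

lemma inner_on_affine:
  shows "inner_on V (\<lambda>u. r * c u + s) x = r * inner_on V c x + s * (\<Sum>u\<in>V. x u)"
    "inner_on V (\<lambda>u. r * c u + s) (\<lambda>u. r * c u + s)
       = r\<^sup>2 * inner_on V c c + 2 * r * s * (\<Sum>u\<in>V. c u) + s\<^sup>2 * card V"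
proof -
  have "(r * c u + s) * x u = r * (c u * x u) + s * x u" for u by (simp add: algebra_simps)
  then show "inner_on V (\<lambda>u. r * c u + s) x = r * inner_on V c x + s * (\<Sum>u\<in>V. x u)"
    by (simp add: inner_on_def sum.distrib flip: sum_distrib_left)
  have "(r * c u + s) * (r * c u + s) = r\<^sup>2 * (c u * c u) + 2 * r * s * c u + s\<^sup>2" for u
    by (simp add: power2_eq_square algebra_simps)
  then show "inner_on V (\<lambda>u. r * c u + s) (\<lambda>u. r * c u + s)
       = r\<^sup>2 * inner_on V c c + 2 * r * s * (\<Sum>u\<in>V. c u) + s\<^sup>2 * card V"
    by (simp add: inner_on_def sum.distrib flip: sum_distrib_left)
qed

lemma edge_form_dominating:
  fixes x :: "'a \<Rightarrow> real"
  assumes "simple_graph V E" "v \<notin> V"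
  shows "edge_form (E \<union> {{u, v} | u. u \<in> V}) x
      = edge_form E x + card V * (x v)\<^sup>2 + 2 * x v * (\<Sum>u\<in>V. x u) + inner_on V x x"
    and "card (E \<union> {{u, v} | u. u \<in> V}) = card E + card V"
proof -
  have V: "finite V" and E: "finite E" "\<And>e. e \<in> E \<Longrightarrow> e \<subseteq> V"
    using assms(1) finite_subset[of E "Pow V"] by (auto simp: simple_graph_def)
  have star: "{{u, v} | u. u \<in> V} = (\<lambda>u. {u, v}) ` V" by auto
  have inj: "inj_on (\<lambda>u. {u, v}) V" by (auto simp: inj_on_def doubleton_eq_iff)
  have disj: "E \<inter> (\<lambda>u. {u, v}) ` V = {}" using E(2) assms(2) by auto
  show "card (E \<union> {{u, v} | u. u \<in> V}) = card E + card V"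
    unfolding star using E(1) V disj by (simp add: card_Un_disjoint card_image[OF inj])
  have "edge_form (E \<union> {{u, v} | u. u \<in> V}) x = edge_form E x + (\<Sum>u\<in>V. (\<Sum>i\<in>{u, v}. x i)\<^sup>2)"
    unfolding star edge_form_def using E(1) V disj
    by (simp add: sum.union_disjoint sum.reindex[OF inj])
  also have "(\<Sum>u\<in>V. (\<Sum>i\<in>{u, v}. x i)\<^sup>2) = (\<Sum>u\<in>V. (x u + x v)\<^sup>2)"
  proof (intro sum.cong refl)
    fix u assume "u \<in> V"
    then have "u \<noteq> v" using assms(2) by auto
    then show "(\<Sum>i\<in>{u, v}. x i)\<^sup>2 = (x u + x v)\<^sup>2" by simp
  qed
  also have "\<dots> = card V * (x v)\<^sup>2 + 2 * x v * (\<Sum>u\<in>V. x u) + inner_on V x x"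
  proof -
    have "(x u + x v)\<^sup>2 = (x v)\<^sup>2 + 2 * x v * x u + x u * x u" for u
      by (simp add: power2_eq_square algebra_simps)
    then show ?thesis by (simp add: inner_on_def sum.distrib flip: sum_distrib_left)
  qed
  finally show "edge_form (E \<union> {{u, v} | u. u \<in> V}) x
      = edge_form E x + card V * (x v)\<^sup>2 + 2 * x v * (\<Sum>u\<in>V. x u) + inner_on V x x" by simp
qed

text \<open>A uniform description of diagonal and off-diagonal entries: two distinct vertices lie in at most one common edge.\<close>
lemma signless_laplacian_index:
  assumes "simple_graph (set vs) E" "distinct vs" "i < length vs" "j < length vs"
  shows "signless_laplacian vs E $$ (i, j) = card {e \<in> E. vs ! i \<in> e \<and> vs ! j \<in> e}"
proof (cases "i = j")
  case True
  have "{vs ! i, vs ! i} \<notin> E" using assms(1) by (auto simp: simple_graph_def)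
  with True assms show ?thesis
    by (simp add: signless_laplacian_def degree_matrix_def adjacency_matrix_def vertex_degree_def)
next
  case False
  then have ne: "vs ! i \<noteq> vs ! j" using assms by (simp add: nth_eq_iff_index_eq)
  have "e = {vs ! i, vs ! j}" if "e \<in> E" "vs ! i \<in> e" "vs ! j \<in> e" for e
    using that ne assms(1) unfolding simple_graph_def by (fastforce simp: card_2_iff)
  then have "{e \<in> E. vs ! i \<in> e \<and> vs ! j \<in> e} = {{vs ! i, vs ! j}} \<inter> E"
    by blast
  with False assms show ?thesis
    by (simp add: Int_insert_left signless_laplacian_def degree_matrix_def adjacency_matrix_def)
qed

lemma sum_set_conv_nth:
  assumes "distinct vs"
  shows "(\<Sum>v\<in>set vs. f v) = (\<Sum>j<length vs. f (vs ! j))"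
  using sum.reindex_bij_betw[OF bij_betw_nth[OF assms refl refl], of f] by simp

lemma sum_edge_conv_inner_on:
  assumes "finite V" "e \<subseteq> V"
  shows "(\<Sum>u\<in>e. x u) = inner_on V (\<lambda>v. of_bool (v \<in> e)) x"
  using assms by (simp add: inner_on_def sum_of_bool_mult_eq Int_absorb1)

lemma edge_form_eq_signless_laplacian:
  assumes G: "simple_graph (set vs) E" and vs: "distinct vs"
  shows "edge_form E x = (\<Sum>i<length vs. \<Sum>j<length vs.
    x (vs ! i) * signless_laplacian vs E $$ (i, j) * x (vs ! j))"
proof -
  let ?n = "length vs" and ?V = "set vs"
  have E: "finite E" "\<And>e. e \<in> E \<Longrightarrow> e \<subseteq> ?V"
    using G finite_subset[of E "Pow ?V"] by (auto simp: simple_graph_def)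
  have "edge_form E x = (\<Sum>e\<in>E. \<Sum>i<?n. \<Sum>j<?n.
      x (vs ! i) * x (vs ! j) * of_bool (vs ! i \<in> e \<and> vs ! j \<in> e))"
    unfolding edge_form_def
  proof (intro sum.cong refl)
    fix e assume "e \<in> E"
    have "(\<Sum>u\<in>e. x u) = (\<Sum>i<?n. of_bool (vs ! i \<in> e) * x (vs ! i))"
      unfolding sum_edge_conv_inner_on[OF finite_set E(2)[OF \<open>e \<in> E\<close>]] inner_on_def
      by (rule sum_set_conv_nth[OF vs])
    then show "(\<Sum>u\<in>e. x u)\<^sup>2 = (\<Sum>i<?n. \<Sum>j<?n.
        x (vs ! i) * x (vs ! j) * of_bool (vs ! i \<in> e \<and> vs ! j \<in> e))"
      by (simp add: power2_eq_square sum_product of_bool_conj mult_ac del: sum_of_bool_mult_eq sum_mult_of_bool_eq)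
  qed
  also have "\<dots> = (\<Sum>i<?n. \<Sum>j<?n. \<Sum>e\<in>E.
      x (vs ! i) * x (vs ! j) * of_bool (vs ! i \<in> e \<and> vs ! j \<in> e))"
    by (subst sum.swap, rule sum.cong[OF refl], subst sum.swap, rule refl)
  also have "\<dots> = (\<Sum>i<?n. \<Sum>j<?n. x (vs ! i) * signless_laplacian vs E $$ (i, j) * x (vs ! j))"
    by (intro sum.cong refl)
      (use E in \<open>simp add: signless_laplacian_index[OF G vs] Int_def mult_ac sum_of_bool_eq flip: sum_distrib_left
        del: sum_of_bool_mult_eq sum_mult_of_bool_eq\<close>)
  finally show ?thesis .
qed

text \<open>The columns of an orthogonal diagonalization, read as functions on the vertices. The last property is Parseval's
identity: the rows of an orthogonal square matrix are orthonormal as well.\<close>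
lemma orthonormal_eigenbasis:
  fixes vs :: "'a list"
  assumes G: "simple_graph (set vs) E" and vs: "distinct vs"
  obtains X :: "nat \<Rightarrow> 'a \<Rightarrow> real" where
    "\<And>i. i < length vs \<Longrightarrow> inner_on (set vs) (X i) (X i) = 1"
    "\<And>i. i < length vs \<Longrightarrow> edge_form E (X i) = asc_eigenvalues (signless_laplacian vs E) ! i"
    "\<And>y. (\<Sum>i<length vs. (inner_on (set vs) y (X i))\<^sup>2) = inner_on (set vs) y y"
proof -
  let ?n = "length vs" and ?Q = "signless_laplacian vs E"
  let ?es = "asc_eigenvalues ?Q"
  have Q: "?Q \<in> carrier_mat ?n ?n" by simp
  obtain U where U: "U \<in> carrier_mat ?n ?n" "U\<^sup>T * U = 1\<^sub>m ?n"
    and es: "diag_mat (U\<^sup>T * ?Q * U) = ?es"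
    using symmetric_orthogonal_diagonalization[OF Q transpose_signless_laplacian
      char_poly_eq_prod_asc_eigenvalues[OF Q transpose_signless_laplacian]] .
  have UU: "U * U\<^sup>T = 1\<^sub>m ?n" using mat_mult_left_right_inverse[OF _ U(1) U(2)] U(1) by simp
  define X where "X i v = U $$ (inv_into {..<?n} ((!) vs) v, i)" for i v
  have X: "X i (vs ! j) = U $$ (j, i)" if "j < ?n" for i j
    using that inj_on_nth[OF vs, of "{..<?n}"] by (simp add: X_def)
  have inner: "inner_on (set vs) y (X i) = (\<Sum>j<?n. y (vs ! j) * U $$ (j, i))" for y i
    by (simp add: inner_on_def sum_set_conv_nth[OF vs] X)
  have unit: "inner_on (set vs) (X i) (X i) = 1" if i: "i < ?n" for i
  proof -
    have "inner_on (set vs) (X i) (X i) = (U\<^sup>T * U) $$ (i, i)"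
      using U(1) i by (simp add: inner X scalar_prod_def atLeast0LessThan)
    then show ?thesis using i by (simp add: U(2))
  qed
  have eig: "edge_form E (X i) = ?es ! i" if i: "i < ?n" for i
  proof -
    have "?es ! i = (U\<^sup>T * ?Q * U) $$ (i, i)"
      using U(1) i by (simp flip: es add: diag_mat_def)
    also have "\<dots> = (U\<^sup>T * (?Q * U)) $$ (i, i)"
      using U(1) Q by (simp add: assoc_mult_mat[of _ ?n ?n _ ?n _ ?n])
    also have "\<dots> = (\<Sum>j<?n. U $$ (j, i) * (\<Sum>k<?n. ?Q $$ (j, k) * U $$ (k, i)))"
      using U(1) Q i by (simp add: scalar_prod_def atLeast0LessThan del: signless_laplacian_carrier)
    also have "\<dots> = edge_form E (X i)"
      by (simp add: edge_form_eq_signless_laplacian[OF G vs] X sum_distrib_left mult.assoc)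
    finally show ?thesis by simp
  qed
  have parseval: "(\<Sum>i<?n. (inner_on (set vs) y (X i))\<^sup>2) = inner_on (set vs) y y" for y
  proof -
    have "(\<Sum>i<?n. (inner_on (set vs) y (X i))\<^sup>2)
        = (\<Sum>i<?n. \<Sum>j<?n. \<Sum>k<?n. y (vs ! j) * y (vs ! k) * (U $$ (j, i) * U $$ (k, i)))"
      by (simp add: inner power2_eq_square sum_product mult_ac)
    also have "\<dots> = (\<Sum>j<?n. \<Sum>k<?n. \<Sum>i<?n. y (vs ! j) * y (vs ! k) * (U $$ (j, i) * U $$ (k, i)))"
      by (subst sum.swap, rule sum.cong[OF refl], subst sum.swap, rule refl)
    also have "\<dots> = (\<Sum>j<?n. \<Sum>k<?n. y (vs ! j) * y (vs ! k) * (U * U\<^sup>T) $$ (j, k))"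
      using U(1) by (intro sum.cong refl) (simp add: scalar_prod_def atLeast0LessThan sum_distrib_left)
    also have "\<dots> = inner_on (set vs) y y"
      by (simp add: UU inner_on_def sum_set_conv_nth[OF vs] if_distrib[of "(*) _"] cong: if_cong)
    finally show ?thesis .
  qed
  from that[of X] unit eig parseval show ?thesis by blast
qed

section \<open>The inequality behind a dominating vertex\<close>

lemma binary_quadratic_form_nonneg:
  fixes p q r x y :: real
  assumes "p \<ge> 0" "r \<ge> 0" "q\<^sup>2 \<le> p * r"
  shows "0 \<le> p * x\<^sup>2 + 2 * q * x * y + r * y\<^sup>2"
proof (cases "p = 0")
  case True
  then show ?thesis using assms by simp
next
  case False
  have "p * (p * x\<^sup>2 + 2 * q * x * y + r * y\<^sup>2) = (p * x + q * y)\<^sup>2 + (p * r - q\<^sup>2) * y\<^sup>2"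
    by (simp add: power2_eq_square algebra_simps)
  also have "\<dots> \<ge> 0" using assms by simp
  finally show ?thesis using False assms(1) by (simp add: zero_le_mult_iff)
qed

text \<open>Clearing denominators turns the inequality into nonnegativity of a binary form
\<open>p w\<^sup>2 + 2 q w y + r y\<^sup>2\<close>. The coefficients \<open>p\<close> and \<open>r\<close> are polynomials in \<open>S - 1\<close> and \<open>b\<close> with
nonnegative coefficients, and the discriminant condition holds because \<open>p r - q\<^sup>2\<close> is a product of nonnegative factors.\<close>
lemma dominating_step_form_reduced:
  fixes S b P D K y w :: real
  assumes S: "S \<ge> 1" and b: "b \<ge> 0"
  defines "P \<equiv> S * (b + 1) + 1" and "D \<equiv> S * (2 * b + 1) + 1"
  defines "K \<equiv> S * D - 2 * b"
  shows "(K * y + (S + 1) * w)\<^sup>2 / (D\<^sup>2 * (S + 1)) \<le> (S - 1) * y\<^sup>2 + (y + S * w)\<^sup>2 / P"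
proof -
  define t where "t = S - 1"
  have t: "t \<ge> 0" and St: "S = t + 1" using S by (auto simp: t_def)
  have P: "P > 0" and D: "D > 0" using S b by (auto simp: P_def D_def intro!: add_nonneg_pos)
  define p q r where "p = S\<^sup>2 * D\<^sup>2 * (S + 1) - (S + 1)\<^sup>2 * P"
    and "q = S * D\<^sup>2 * (S + 1) - P * K * (S + 1)"
    and "r = ((S - 1) * P + 1) * D\<^sup>2 * (S + 1) - P * K\<^sup>2"
  note expand = P_def D_def K_def St power2_eq_square algebra_simps
  have "p = (t + 2) * (4*t^4*b\<^sup>2 + 16*t^3*b\<^sup>2 + 4*t^4*b + 20*t^3*b + 24*t\<^sup>2*b\<^sup>2 + 35*t\<^sup>2*b + t^4 + 6*t^3
     + 12*t\<^sup>2 + 16*t*b\<^sup>2 + 25*t*b + 8*t + 4*b\<^sup>2 + 6*b)"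
    unfolding p_def by (simp add: expand power_numeral_reduce)
  then have "p \<ge> 0" using t b by simp
  have "r = 4*t^3*b^3 + 8*t^3*b\<^sup>2 + 3*t^3*b + 12*t\<^sup>2*b^3 + 32*t\<^sup>2*b\<^sup>2 + 15*t\<^sup>2*b + 8*t*b^3
     + 36*t*b\<^sup>2 + 24*t*b + 8*b\<^sup>2 + 12*b"
    unfolding r_def by (simp add: expand power_numeral_reduce)
  then have "r \<ge> 0" using t b by simp
  moreover have "p * r - q\<^sup>2 = P * D\<^sup>2 * (S + 1) *
      ((S * D)\<^sup>2 * (S + 1) * (S - 1) - (S * K)\<^sup>2 - (S + 1)\<^sup>2 * ((S - 1) * P + 1) + 2 * S * (S + 1) * K)"
    unfolding p_def q_def r_def by (simp add: power2_eq_square algebra_simps)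
  moreover have "(S * D)\<^sup>2 * (S + 1) * (S - 1) - (S * K)\<^sup>2 - (S + 1)\<^sup>2 * ((S - 1) * P + 1) + 2 * S * (S + 1) * K
      = (S + 1) * (S * b * (S - 1)) * (4 * S * b + 3 * (S + 1))"
    unfolding P_def D_def K_def by (simp add: power2_eq_square algebra_simps)
  ultimately have "p * r - q\<^sup>2 \<ge> 0" using S b P by simp
  then have "q\<^sup>2 \<le> p * r" by simp
  with \<open>p \<ge> 0\<close> \<open>r \<ge> 0\<close> have "0 \<le> p * w\<^sup>2 + 2 * q * w * y + r * y\<^sup>2"
    by (rule binary_quadratic_form_nonneg)
  also have "\<dots> = ((S - 1) * P * y\<^sup>2 + (y + S * w)\<^sup>2) * (D\<^sup>2 * (S + 1)) - P * (K * y + (S + 1) * w)\<^sup>2"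
    unfolding p_def q_def r_def by (simp add: power2_eq_square algebra_simps)
  finally have "P * (K * y + (S + 1) * w)\<^sup>2 \<le> ((S - 1) * P * y\<^sup>2 + (y + S * w)\<^sup>2) * (D\<^sup>2 * (S + 1))"
    by simp
  moreover have "l / d \<le> u / P" if "P * l \<le> u * d" "d > 0" for l u d
    using that P by (simp add: field_simps)
  ultimately have "(K * y + (S + 1) * w)\<^sup>2 / (D\<^sup>2 * (S + 1)) \<le> ((S - 1) * P * y\<^sup>2 + (y + S * w)\<^sup>2) / P"
    using D S by simp
  then show ?thesis using P by (simp add: add_divide_distrib)
qed

text \<open>In the application \<open>S = h + 1\<close>, \<open>b = n - h - 1\<close>, \<open>a\<close> is the value of a vector \<open>x\<close> at the new vertex,
\<open>y\<close> its inner product with \<open>c\<close>, and \<open>w\<close> its inner product with \<open>1 - c\<close>. On the right,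
\<open>b a\<^sup>2 + 2 a (y + w)\<close> comes from bordering the matrix, \<open>(S - 1) / S y\<^sup>2\<close> from the old bound
\<open>h / (h + 1) c c\<^sup>T\<close>, and the last square from the new unit vector; on the left is the new bound.

The difference of the two sides vanishes along \<open>(a, y, w) = (1, - 1, - b)\<close>, the direction of the new vector. It
therefore depends only on \<open>y + a\<close> and \<open>w + b a\<close>, and the case \<open>a = 0\<close> is enough.\<close>
lemma dominating_step_form:
  fixes S b D a y w :: real
  assumes S: "S \<ge> 1" and b: "b \<ge> 0"
  defines "D \<equiv> S * (2 * b + 1) + 1"
  shows "((S + b / D * (S - 1)) * a + (S - 2 * b / D) * y + (S + 1) / D * w)\<^sup>2 / (S * (S + 1))
    \<le> b * a\<^sup>2 + 2 * a * (y + w) + (S - 1) / S * y\<^sup>2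
       + (S * a - y - S * w)\<^sup>2 / (S * (S * (b + 1) + 1))"
proof -
  define P where "P = S * (b + 1) + 1"
  have P: "P > 0" and D: "D > 0" using S b by (auto simp: P_def D_def intro!: add_nonneg_pos)
  define y' w' where "y' = y + a" and "w' = w + b * a"
  have "(S + b / D * (S - 1)) * a + (S - 2 * b / D) * y + (S + 1) / D * w
      = ((S * D - 2 * b) * y' + (S + 1) * w') / D"
    using D by (simp add: field_simps y'_def w'_def)
  then have "((S + b / D * (S - 1)) * a + (S - 2 * b / D) * y + (S + 1) / D * w)\<^sup>2 / (S * (S + 1))
    = ((S * D - 2 * b) * y' + (S + 1) * w')\<^sup>2 / (D\<^sup>2 * (S + 1)) / S"
    by (simp add: power_divide)
  also have "\<dots> \<le> ((S - 1) * y'\<^sup>2 + (y' + S * w')\<^sup>2 / P) / S"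
    unfolding P_def D_def by (rule divide_right_mono[OF dominating_step_form_reduced]) (use S b in auto)
  also have "(y' + S * w')\<^sup>2 / P = (S * a - y - S * w)\<^sup>2 / P + 2 * a * (y' + S * w') - a\<^sup>2 * P"
  proof -
    define z where "z = S * a - y - S * w"
    have eq: "y' + S * w' = P * a - z"
      by (simp add: P_def y'_def w'_def z_def algebra_simps)
    show ?thesis unfolding eq z_def[symmetric] using P by (simp add: field_simps power2_eq_square)
  qed
  also have "((S - 1) * y'\<^sup>2 + ((S * a - y - S * w)\<^sup>2 / P + 2 * a * (y' + S * w') - a\<^sup>2 * P)) / S
    = b * a\<^sup>2 + 2 * a * (y + w) + (S - 1) / S * y\<^sup>2 + (S * a - y - S * w)\<^sup>2 / (S * P)"
    using S P by (simp add: field_simps power2_eq_square y'_def w'_def, simp add: P_def algebra_simps)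
  finally show ?thesis by (simp add: P_def)
qed

section \<open>Certificates for threshold graphs\<close>

text \<open>The induction invariant. The vectors \<open>zs\<close> lift \<open>Q - h I\<close> above the rank-one form \<open>h / (h + 1) c c\<^sup>T\<close>, and
their squared lengths bound how far the eigenvalues below \<open>h\<close> fall short of \<open>h\<close> in total.\<close>
definition eigenvalue_certificate ::
    "'a set \<Rightarrow> 'a set set \<Rightarrow> nat \<Rightarrow> ('a \<Rightarrow> real) list \<Rightarrow> ('a \<Rightarrow> real) \<Rightarrow> bool" where
  "eigenvalue_certificate V E h zs c \<longleftrightarrow>
     h + 1 \<le> card V \<and> (\<Sum>v\<in>V. c v) = real h + 1 \<and> inner_on V c c \<le> real h + 1 \<and>
     (\<Sum>z\<leftarrow>zs. inner_on V z z) \<le> real (card V) * real h - real (card E) - real (h choose 2) \<and>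
     (\<forall>x. real h / (real h + 1) * (inner_on V c x)\<^sup>2
        \<le> edge_form E x - real h * inner_on V x x + (\<Sum>z\<leftarrow>zs. (inner_on V z x)\<^sup>2))"

lemma certificate_isolated:
  assumes cert: "eigenvalue_certificate V E h zs c" and V: "finite V" "v \<notin> V"
  shows "eigenvalue_certificate (insert v V) E h
    ((\<lambda>u. if u = v then sqrt h else 0) # map (\<lambda>z. z(v := 0)) zs) (c(v := 0))"
proof -
  let ?e = "\<lambda>u. if u = v then sqrt h else 0"
  have e: "inner_on V ?e y = 0" for y using V by (auto simp: inner_on_def intro!: sum.neutral)
  have "(\<Sum>u\<in>V. (c(v := 0)) u) = (\<Sum>u\<in>V. c u)" using V by (intro sum.cong) auto
  with cert V show ?thesis
    unfolding eigenvalue_certificate_def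
    by (simp add: inner_on_insert e o_def algebra_simps power_mult_distrib flip: power2_eq_square)
qed

text \<open>Write \<open>S = h + 1\<close> and \<open>b = n - S\<close>. If \<open>c\<close> has squared length exactly \<open>S\<close>, the matrix obtained by bordering
\<open>(S - 1) / S c c\<^sup>T\<close> by ones, with corner \<open>b\<close>, has the single negative eigenvalue \<open>- 1\<close>, with eigenvector
\<open>(S, (S - 1) c - S 1)\<close>; its normalization is the new vector \<open>z\<close>. The new bound \<open>c'\<close> is orthogonal to \<open>z\<close> in
this case. The obvious candidate \<open>(1, c)\<close>, right for the complete graph, where \<open>b = 0\<close>, fails narrowly for
\<open>b > 0\<close>; it is corrected by the small multiple \<open>1 / (S D)\<close> of the vector
\<open>(b (S - 1), - 2 b c + (S + 1) (1 - c))\<close>, which is also orthogonal to \<open>z\<close> and whose entries add up to \<open>0\<close>.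
If \<open>c\<close> is shorter, the same formulas work, since the lengths of \<open>z\<close> and \<open>c'\<close> only decrease.\<close>
lemma certificate_dominating:
  assumes cert: "eigenvalue_certificate V E h zs c" and G: "simple_graph V E" and v: "v \<notin> V"
  shows "\<exists>zs' c'. eigenvalue_certificate (insert v V) (E \<union> {{u, v} | u. u \<in> V}) (Suc h) zs' c'"
proof -
  define S b where "S = real h + 1" and "b = real (card V) - S"
  define P D where "P = S * (b + 1) + 1" and "D = S * (2 * b + 1) + 1"
  \<comment> \<open>On the old vertices \<open>c'\<close> is \<open>m c + k (1 - c)\<close>.\<close>
  define m k where "m = (S - 2 * b / D) / S" and "k = (S + 1) / D / S"
  define r where "r = sqrt (S * P)"
  define p q where "p = (S - 1) / r" and "q = - S / r"
  define z where "z = (\<lambda>u. p * c u + q)(v := S / r)"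
  define c' where "c' = (\<lambda>u. (m - k) * c u + k)(v := (S + b / D * (S - 1)) / S)"
  have V: "finite V" using G by (simp add: simple_graph_def)
  have S: "S \<ge> 1" "real h = S - 1" and b: "b \<ge> 0" and n: "real (card V) = S + b"
    and c: "(\<Sum>u\<in>V. c u) = S" "inner_on V c c \<le> S"
    using cert by (auto simp: S_def b_def eigenvalue_certificate_def)
  have P: "P > 0" and D: "D > 0" using S b by (auto simp: P_def D_def intro!: add_nonneg_pos)
  have r: "r > 0" "r\<^sup>2 = S * P" using S P by (auto simp: r_def)

  have "inner_on (insert v V) z z \<le> 1"
  proof -
    have "inner_on (insert v V) z z = (S / r)\<^sup>2 + p\<^sup>2 * inner_on V c c + 2 * p * q * S + q\<^sup>2 * (S + b)"
      using V v n c by (simp add: z_def inner_on_insert inner_on_affine(2) power2_eq_square)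
    also have "\<dots> \<le> (S / r)\<^sup>2 + p\<^sup>2 * S + 2 * p * q * S + q\<^sup>2 * (S + b)"
      using c by (intro add_right_mono add_left_mono mult_left_mono) auto
    also have "\<dots> = S * P / r\<^sup>2"
      by (simp add: p_def q_def P_def power2_eq_square add_divide_distrib diff_divide_distrib algebra_simps)
    also have "\<dots> = 1" using r S P by simp
    finally show ?thesis .
  qed
  moreover have "(\<Sum>u\<in>insert v V. c' u) = S + 1"
  proof -
    have "(\<Sum>u\<in>V. c' u) = (\<Sum>u\<in>V. (m - k) * c u + k)"
      using v by (intro sum.cong) (auto simp: c'_def)
    also have "\<dots> = (m - k) * S + k * (S + b)"
      using V c n by (simp add: sum.distrib flip: sum_distrib_left)
    finally have "(\<Sum>u\<in>insert v V. c' u) = (S + b / D * (S - 1)) / S + m * S + k * b"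
      using V v by (simp add: c'_def algebra_simps)
    also have "\<dots> = S + 1" using S D by (simp add: m_def k_def field_simps)
    finally show ?thesis .
  qed
  moreover have "inner_on (insert v V) c' c' \<le> S + 1"
  proof -
    have "inner_on (insert v V) c' c' = ((S + b / D * (S - 1)) / S)\<^sup>2 + (m - k)\<^sup>2 * inner_on V c c
        + 2 * (m - k) * k * S + k\<^sup>2 * (S + b)"
      using V v n c by (simp add: c'_def inner_on_insert inner_on_affine(2) power2_eq_square)
    also have "\<dots> \<le> ((S + b / D * (S - 1)) / S)\<^sup>2 + (m - k)\<^sup>2 * S + 2 * (m - k) * k * S + k\<^sup>2 * (S + b)"
      using c by (intro add_right_mono add_left_mono mult_left_mono) auto
    also have "\<dots> = ((S + b / D * (S - 1)) / S)\<^sup>2 + m\<^sup>2 * S + k\<^sup>2 * b"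
      by (simp add: power2_eq_square algebra_simps)
    also have "\<dots> = S + 1 - b * (S + 1) * (2 * S * D - (S + 1) * (b + 1)) / (D\<^sup>2 * S\<^sup>2)"
      using S D by (simp add: m_def k_def field_simps power2_eq_square)
    also have "\<dots> \<le> S + 1"
    proof -
      have "(S + 1) * (b + 1) \<le> (2 * S) * D"
      proof (rule mult_mono)
        have "1 * (b + 1) \<le> S * (2 * b + 1)" using S b by (intro mult_mono) auto
        then show "b + 1 \<le> D" by (simp add: D_def)
      qed (use S b in auto)
      then show ?thesis using S b D by simp
    qed
    finally show ?thesis .
  qed
  moreover have "S / (S + 1) * (inner_on (insert v V) c' x)\<^sup>2
      \<le> edge_form (E \<union> {{u, v} | u. u \<in> V}) x - S * inner_on (insert v V) x x
        + ((inner_on (insert v V) z x)\<^sup>2 + (\<Sum>z\<leftarrow>zs. (inner_on V z x)\<^sup>2))" for x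
  proof -
    define a y w where "a = x v" and "y = inner_on V c x" and "w = (\<Sum>u\<in>V. x u) - y"
    have "inner_on (insert v V) c' x = (S + b / D * (S - 1)) / S * a + ((m - k) * y + k * (y + w))"
      using V v by (simp add: c'_def inner_on_insert inner_on_affine(1) a_def w_def y_def)
    also have "\<dots> = ((S + b / D * (S - 1)) * a + (S - 2 * b / D) * y + (S + 1) / D * w) / S"
      using S D by (simp add: m_def k_def field_simps)
    finally have c'x: "inner_on (insert v V) c' x
        = ((S + b / D * (S - 1)) * a + (S - 2 * b / D) * y + (S + 1) / D * w) / S" .
    have "S / (S + 1) * (inner_on (insert v V) c' x)\<^sup>2
        = ((S + b / D * (S - 1)) * a + (S - 2 * b / D) * y + (S + 1) / D * w)\<^sup>2 / (S * (S + 1))"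
      using S unfolding c'x by (simp add: power_divide power2_eq_square)
    also have "\<dots> \<le> b * a\<^sup>2 + 2 * a * (y + w) + (S - 1) / S * y\<^sup>2 + (S * a - y - S * w)\<^sup>2 / (S * P)"
      unfolding D_def P_def using S(1) b by (rule dominating_step_form)
    also have "(S * a - y - S * w)\<^sup>2 / (S * P) = (inner_on (insert v V) z x)\<^sup>2"
    proof -
      have "inner_on (insert v V) z x = (S * a - y - S * w) / r"
        using V v r by (simp add: z_def inner_on_insert inner_on_affine(1) a_def w_def flip: y_def)
          (simp add: p_def q_def field_simps)
      then show ?thesis using r by (simp add: power_divide)
    qed
    also have "(S - 1) / S * y\<^sup>2 \<le> edge_form E x - (S - 1) * inner_on V x x + (\<Sum>z\<leftarrow>zs. (inner_on V z x)\<^sup>2)"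
      using cert by (simp add: eigenvalue_certificate_def y_def S_def)
    finally show ?thesis
      using V v n unfolding edge_form_dominating(1)[OF G v]
      by (simp add: inner_on_insert a_def w_def algebra_simps power2_eq_square)
  qed
  moreover have "real (Suc h choose 2) = real (h choose 2) + real h"
    by (simp add: numeral_2_eq_2)
  ultimately have "eigenvalue_certificate (insert v V) (E \<union> {{u, v} | u. u \<in> V}) (Suc h)
      (z # map (\<lambda>z. z(v := 0)) zs) c'"
    using cert V v edge_form_dominating(2)[OF G v]
    unfolding eigenvalue_certificate_def
    by (simp add: S_def inner_on_extend_by_zero o_def algebra_simps)
  then show ?thesis by blast
qed

lemma threshold_graph_certificate:
  assumes "threshold_graph V E"
  shows "\<exists>h zs c. eigenvalue_certificate V E h zs c"
  using assms
proof (induction rule: threshold_graph.induct)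
  case (single v)
  have "eigenvalue_certificate {v} {} 0 [] (\<lambda>_. 1)"
    by (simp add: eigenvalue_certificate_def inner_on_def edge_form_def)
  then show ?case by blast
next
  case (isolated V E v)
  then obtain h zs c where "eigenvalue_certificate V E h zs c" by blast
  moreover have "finite V"
    using threshold_graph_simple_graph[OF isolated.hyps(1)] by (simp add: simple_graph_def)
  ultimately have "eigenvalue_certificate (insert v V) E h
      ((\<lambda>u. if u = v then sqrt h else 0) # map (\<lambda>z. z(v := 0)) zs) (c(v := 0))"
    using isolated.hyps(2) by (rule certificate_isolated)
  then show ?case by blast
next
  case (dominating V E v)
  then obtain h zs c where "eigenvalue_certificate V E h zs c" by blast
  from certificate_dominating[OF this threshold_graph_simple_graph[OF dominating.hyps(1)] dominating.hyps(2)]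
  show ?case by blast
qed

section \<open>Sums of the largest eigenvalues\<close>

text \<open>The bound is obtained from below: the eigenvalues other than the \<open>k\<close> largest sum to at least \<open>(n - k) h\<close> minus the
squared lengths of the vectors \<open>zs\<close>, by Bessel's inequality, and the sum of all eigenvalues is \<open>2 |E|\<close>.\<close>
lemma certificate_eigenvalue_sum:
  assumes cert: "eigenvalue_certificate (set vs) E h zs c"
    and G: "simple_graph (set vs) E" and vs: "distinct vs" and k: "k \<le> length vs"
  shows "(\<Sum>i = length vs - k..<length vs. asc_eigenvalues (signless_laplacian vs E) ! i)
    \<le> real (card E) + real k * real h - real (h choose 2)"
proof -
  let ?n = "length vs" and ?V = "set vs" and ?l = "\<lambda>i. asc_eigenvalues (signless_laplacian vs E) ! i"
  obtain X where unit: "\<And>i. i < ?n \<Longrightarrow> inner_on ?V (X i) (X i) = 1"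
    and eig: "\<And>i. i < ?n \<Longrightarrow> edge_form E (X i) = ?l i"
    and parseval: "\<And>y. (\<Sum>i<?n. (inner_on ?V y (X i))\<^sup>2) = inner_on ?V y y"
    using orthonormal_eigenbasis[OF G vs] by blast
  have E: "e \<subseteq> ?V" "card e = 2" if "e \<in> E" for e using that G by (auto simp: simple_graph_def)
  \<comment> \<open>Each edge contributes the squared length \<open>2\<close> of its indicator vector to the trace.\<close>
  have "(\<Sum>i<?n. ?l i) = (\<Sum>i<?n. \<Sum>e\<in>E. (inner_on ?V (\<lambda>v. of_bool (v \<in> e)) (X i))\<^sup>2)"
    using E by (simp add: eig[symmetric] edge_form_def sum_edge_conv_inner_on[of ?V])
  also have "\<dots> = (\<Sum>e\<in>E. inner_on ?V (\<lambda>v. of_bool (v \<in> e)) (\<lambda>v. of_bool (v \<in> e)))"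
    by (subst sum.swap) (simp add: parseval)
  also have "\<dots> = (\<Sum>e\<in>E. 2)"
    by (intro sum.cong refl) (simp add: sum_edge_conv_inner_on[of ?V, symmetric] E)
  finally have total: "(\<Sum>i<?n. ?l i) = 2 * card E" by simp

  have "real h - (\<Sum>z\<leftarrow>zs. (inner_on ?V z (X i))\<^sup>2) \<le> ?l i" if "i < ?n" for i
  proof -
    have "0 \<le> real h / (real h + 1) * (inner_on ?V c (X i))\<^sup>2" by simp
    also have "\<dots> \<le> edge_form E (X i) - real h * inner_on ?V (X i) (X i) + (\<Sum>z\<leftarrow>zs. (inner_on ?V z (X i))\<^sup>2)"
      using cert by (simp add: eigenvalue_certificate_def)
    finally show ?thesis using that by (simp add: eig unit)
  qed
  then have "(\<Sum>i<?n - k. real h - (\<Sum>z\<leftarrow>zs. (inner_on ?V z (X i))\<^sup>2)) \<le> (\<Sum>i<?n - k. ?l i)"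
    by (intro sum_mono) auto
  moreover have "(\<Sum>i<?n - k. \<Sum>z\<leftarrow>zs. (inner_on ?V z (X i))\<^sup>2) \<le> (\<Sum>z\<leftarrow>zs. inner_on ?V z z)"
  proof -
    have "(\<Sum>i<?n - k. \<Sum>z\<leftarrow>zs. (inner_on ?V z (X i))\<^sup>2) = (\<Sum>z\<leftarrow>zs. \<Sum>i<?n - k. (inner_on ?V z (X i))\<^sup>2)"
      by (induction zs) (simp_all add: sum.distrib)
    also have "\<dots> \<le> (\<Sum>z\<leftarrow>zs. inner_on ?V z z)"
      by (intro sum_list_mono) (auto simp flip: parseval intro!: sum_mono2)
    finally show ?thesis .
  qed
  moreover have "(\<Sum>z\<leftarrow>zs. inner_on ?V z z) \<le> real ?n * real h - real (card E) - real (h choose 2)"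
    using cert vs by (simp add: eigenvalue_certificate_def distinct_card)
  moreover have "(\<Sum>i<?n - k. ?l i) + (\<Sum>i = ?n - k..<?n. ?l i) = (\<Sum>i<?n. ?l i)"
    using sum.atLeastLessThan_concat[of 0 "?n - k" ?n ?l] by (simp add: atLeast0LessThan)
  ultimately show ?thesis using total k by (simp add: sum_subtractf of_nat_diff algebra_simps)
qed

text \<open>The difference of the two sides is \<open>(k - h) (k - h + 1) / 2\<close>, half a product of consecutive integers.\<close>
lemma mult_le_choose_two_add:
  "real k * real h \<le> real (h choose 2) + real ((k + 1) choose 2)"
proof -
  have two: "real (m choose 2) = real m * (real m - 1) / 2" for m
    by (induction m) (simp_all add: numeral_2_eq_2 field_simps)
  have "0 \<le> (real k - real h) * (real k - real h + 1)"
  proof (cases "h \<le> k")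
    case False
    then have "real k + 1 \<le> real h" by simp
    then show ?thesis by (simp add: mult_nonpos_nonpos)
  qed simp
  then show ?thesis by (simp add: two field_simps)
qed

theorem theorem19:
  fixes V :: "'a set" and E :: "'a set set" and vs :: "'a list" and n k :: nat
  assumes "threshold_graph V E"
    and "card V = n"
    and "distinct vs" and "set vs = V"
    and "1 \<le> k" and "k \<le> n"
  shows "(\<Sum>i = n + 1 - k..n. asc_eigenvalue (signless_laplacian vs E) i)
           \<le> real (card E) + real ((k + 1) choose 2)"
proof -
  have n: "length vs = n" using assms distinct_card by fastforce
  have G: "simple_graph (set vs) E" using threshold_graph_simple_graph assms by blast
  obtain h zs c where cert: "eigenvalue_certificate (set vs) E h zs c"
    using threshold_graph_certificate assms by blast
  have "{n + 1 - k..n} = {Suc (n - k)..<Suc n}" using assms by auto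
  then have "(\<Sum>i = n + 1 - k..n. asc_eigenvalue (signless_laplacian vs E) i)
      = (\<Sum>i = n - k..<n. asc_eigenvalues (signless_laplacian vs E) ! i)"
    by (simp only: sum.shift_bounds_Suc_ivl) (simp add: asc_eigenvalue_def)
  also have "\<dots> \<le> real (card E) + real k * real h - real (h choose 2)"
    using certificate_eigenvalue_sum[OF cert G assms(3), of k] assms(6) by (simp add: n)
  also have "\<dots> \<le> real (card E) + real ((k + 1) choose 2)"
    using mult_le_choose_two_add[of k h] by simp
  finally show ?thesis .
qed

end
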